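(* Let $P=(X,\prec)$ be a finite poset with $|X|=n$, let $x,y,z\in X$ be distinct, and let $k,\ell\ge1$ be integers. Let $\mathrm{F}(a,b)$ denote the number of linear extensions $L$ of $P$ with $L(y)-L(x)=a$ and $L(z)-L(y)=b$. If $\mathrm{F}(k,\ell)\,\mathrm{F}(k+1,\ell+1)>0$, then $$\mathrm{F}(k+1,\ell)\,\mathrm{F}(k,\ell+1)\ \le\ 2k\ell\,(\min\{k,\ell\}+1)\,n\cdot \mathrm{F}(k,\ell)\,\mathrm{F}(k+1,\ell+1).$$
   Context: A linear extension of a finite poset $P=(X,\prec)$ with $|X|=n$ is a bijection $L:X\to\{1,\dots,n\}$ with $L(u)<L(v)$ whenever $u\prec v$. *)

theory Defs
  imports Complex_Main "HOL-Library.FuncSet"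
begin

definition strict_poset :: "'a set \<Rightarrow> ('a \<Rightarrow> 'a \<Rightarrow> bool) \<Rightarrow> bool" where
  "strict_poset X lt \<longleftrightarrow> irreflp_on X lt \<and> transp_on X lt"

text \<open>The condition \<open>L \<in> extensional X\<close> pins down the values of \<open>L\<close> outside \<open>X\<close>, so that
  counting these total functions amounts to counting maps defined on \<open>X\<close> only.\<close>

definition linear_extensions :: "'a set \<Rightarrow> ('a \<Rightarrow> 'a \<Rightarrow> bool) \<Rightarrow> ('a \<Rightarrow> nat) set" where
  "linear_extensions X lt =
     {L \<in> extensional X. bij_betw L X {1..card X} \<and>
        (\<forall>u\<in>X. \<forall>v\<in>X. lt u v \<longrightarrow> L u < L v)}"

text \<open>The differences are taken in the integers, avoiding truncated subtraction.\<close>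

definition F_count ::
  "'a set \<Rightarrow> ('a \<Rightarrow> 'a \<Rightarrow> bool) \<Rightarrow> 'a \<Rightarrow> 'a \<Rightarrow> 'a \<Rightarrow> int \<Rightarrow> int \<Rightarrow> nat" where
  "F_count X lt x y z a b =
     card {L \<in> linear_extensions X lt.
             int (L y) - int (L x) = a \<and> int (L z) - int (L y) = b}"

end

theory Submission
  imports Defs
begin

text \<open>If \<open>F(k,l) > 0\<close>, an extension witnessing this bounds the number of elements forced to lie
  between \<open>x\<close> and \<open>z\<close>, or between \<open>x\<close> and \<open>y\<close>. So an extension counted by \<open>F(k+1,l)\<close> has an element
  in between that can be moved below \<open>x\<close> or above \<open>z\<close>, after which at most one element must still
  be moved across \<open>y\<close> to obtain an extension counted by \<open>F(k,l)\<close>. Remembering where the moved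
  elements came from costs a factor \<open>2 k l\<close>, whence \<open>F(k+1,l) \<le> 2 k l F(k,l)\<close>. If
  \<open>F(k+1,l+1) > 0\<close>, moving elements inwards gives \<open>F(k+1,l) \<le> (k+1) n F(k+1,l+1)\<close> in the same way.
  Both bounds have versions for \<open>F(k,l+1)\<close> by reversing the order, and the theorem multiplies
  the two that produce the factor \<open>min k l + 1\<close>.\<close>

section \<open>Moving a single element of a linear extension\<close>

text \<open>\<open>slide p q\<close> moves the element at position \<open>p\<close> to position \<open>q\<close>, shifting those in between by one.\<close>

definition slide :: "nat \<Rightarrow> nat \<Rightarrow> nat \<Rightarrow> nat" where
  "slide p q i =
     (if i = p then q
      else if p < i \<and> i \<le> q then i - 1
      else if q \<le> i \<and> i < p then i + 1
      else i)"

definition reposition :: "'a set \<Rightarrow> nat \<Rightarrow> nat \<Rightarrow> ('a \<Rightarrow> nat) \<Rightarrow> 'a \<Rightarrow> nat" where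
  "reposition X p q L = (\<lambda>u\<in>X. slide p q (L u))"

text \<open>Transitivity makes one \<open>lt\<close> step enough, and
  \<open>lt\<inverse>\<inverse>\<close> yields down-closures. Including \<open>A\<close> ensures
  that an element found outside is not one of the marked points in \<open>A\<close>.\<close>

definition up_closure :: "('a \<Rightarrow> 'a \<Rightarrow> bool) \<Rightarrow> 'a set \<Rightarrow> 'a set" where
  "up_closure lt A = A \<union> {u. \<exists>a\<in>A. lt a u}"

text \<open>Natural-number form of the set counted by \<open>F_count\<close>; stating the gaps
  additively avoids truncated subtraction.\<close>

definition gap_extensions ::
  "'a set \<Rightarrow> ('a \<Rightarrow> 'a \<Rightarrow> bool) \<Rightarrow> 'a \<Rightarrow> 'a \<Rightarrow> 'a \<Rightarrow> nat \<Rightarrow> nat \<Rightarrow> ('a \<Rightarrow> nat) set" where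
  "gap_extensions X lt x y z a b =
     {L \<in> linear_extensions X lt. L y = L x + a \<and> L z = L y + b}"

lemma slide_inverse: "slide q p (slide p q i) = i"
  by (auto simp: slide_def)

lemma reposition_apply [simp]: "u \<in> X \<Longrightarrow> reposition X p q L u = slide p q (L u)"
  by (simp add: reposition_def)

text \<open>Makes every move reversible: the original extension is decoded from the result and the
  two positions.\<close>

lemma reposition_inverse:
  assumes "L \<in> linear_extensions X lt"
  shows "reposition X q p (reposition X p q L) = L"
  using assms
  by (auto simp: reposition_def linear_extensions_def slide_inverse fun_eq_iff restrict_def
      extensional_def)

lemma bij_betw_slide:
  assumes "p \<in> {1..n}" "q \<in> {1..n}"
  shows "bij_betw (slide p q) {1..n} {1..n}"
  by (rule bij_betw_byWitness[where f' = "slide q p"])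
    (use assms in \<open>auto simp: slide_inverse\<close>, auto simp: slide_def split: if_splits)

section \<open>Positions in a linear extension\<close>

lemma linear_extension_range:
  assumes "L \<in> linear_extensions X lt" "u \<in> X"
  shows "1 \<le> L u" "L u \<le> card X"
  using assms by (auto simp: linear_extensions_def bij_betw_def)

lemma linear_extension_mono:
  assumes "L \<in> linear_extensions X lt" "u \<in> X" "v \<in> X" "lt u v"
  shows "L u < L v"
  using assms by (auto simp: linear_extensions_def)

lemma linear_extension_inj:
  assumes "L \<in> linear_extensions X lt" "u \<in> X" "v \<in> X"
  shows "L u = L v \<longleftrightarrow> u = v"
  using assms by (auto simp: linear_extensions_def bij_betw_def inj_on_def)

lemma card_positions:
  assumes "L \<in> linear_extensions X lt" "I \<subseteq> {1..card X}"
  shows "card {v \<in> X. L v \<in> I} = card I"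
proof -
  have b: "bij_betw L X {1..card X}"
    using assms by (auto simp: linear_extensions_def)
  have "bij_betw L {v \<in> X. L v \<in> I} I"
    unfolding bij_betw_def
  proof
    show "inj_on L {v \<in> X. L v \<in> I}"
      using b by (auto simp: bij_betw_def inj_on_def)
    show "L ` {v \<in> X. L v \<in> I} = I"
    proof -
      have "L ` {v \<in> X. L v \<in> I} = L ` X \<inter> I" by auto
      then show ?thesis using b assms(2) by (auto simp: bij_betw_def)
    qed
  qed
  then show ?thesis by (rule bij_betw_same_card)
qed

text \<open>Used contrapositively: if \<open>I\<close> is longer than \<open>J\<close>, some element
  that \<open>L\<close> places in \<open>I\<close> is placed outside \<open>J\<close> by
  \<open>M\<close>, so the order does not force it there.\<close>

lemma card_positions_mono:
  assumes "finite X" and L: "L \<in> linear_extensions X lt" and M: "M \<in> linear_extensions X lt"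
    and I: "I \<subseteq> {1..card X}" and J: "J \<subseteq> {1..card X}"
    and "{v \<in> X. L v \<in> I} \<subseteq> {v \<in> X. M v \<in> J}"
  shows "card I \<le> card J"
  using card_mono[OF _ assms(6)] \<open>finite X\<close> card_positions[OF L I] card_positions[OF M J] by simp

section \<open>Moves that respect the order\<close>

text \<open>A slide changes only the order between \<open>w\<close> and the elements it passes, so
  only these comparabilities have to be excluded.\<close>

lemma reposition_linear_extension:
  assumes L: "L \<in> linear_extensions X lt" and "w \<in> X" and q: "q \<in> {1..card X}"
    and lower: "\<And>v. v \<in> X \<Longrightarrow> q \<le> L v \<Longrightarrow> L v < L w \<Longrightarrow> \<not> lt v w"
    and upper: "\<And>v. v \<in> X \<Longrightarrow> L w < L v \<Longrightarrow> L v \<le> q \<Longrightarrow> \<not> lt w v"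
  shows "reposition X (L w) q L \<in> linear_extensions X lt"
proof -
  have bL: "bij_betw L X {1..card X}" using L by (simp add: linear_extensions_def)
  have "bij_betw (slide (L w) q) {1..card X} {1..card X}"
    using linear_extension_range[OF L \<open>w \<in> X\<close>] q by (intro bij_betw_slide) auto
  from bij_betw_trans[OF bL this]
  have "bij_betw (reposition X (L w) q L) X {1..card X}"
    by (rule bij_betw_cong[THEN iffD1, rotated]) simp
  moreover have "slide (L w) q (L u) < slide (L w) q (L v)"
    if uv: "u \<in> X" "v \<in> X" "lt u v" for u v
  proof -
    have "L u < L v" using linear_extension_mono[OF L] uv by blast
    moreover have "\<not> (q \<le> L u \<and> L u < L w)" if "L v = L w"
      using that uv lower[of u] linear_extension_inj[OF L \<open>v \<in> X\<close> \<open>w \<in> X\<close>] by auto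
    moreover have "\<not> (L w < L v \<and> L v \<le> q)" if "L u = L w"
      using that uv upper[of v] linear_extension_inj[OF L \<open>u \<in> X\<close> \<open>w \<in> X\<close>] by auto
    ultimately show ?thesis by (auto simp: slide_def)
  qed
  ultimately show ?thesis
    by (auto simp: linear_extensions_def reposition_def)
qed

text \<open>The first element outside an up-set \<open>Q\<close> lies above no element preceding it in the range,
  so it can be moved down freely.\<close>

lemma move_down_outside_upset:
  assumes L: "L \<in> linear_extensions X lt" and "w \<in> X" "w \<notin> Q" "1 \<le> q" "q \<le> L w"
    and Q: "\<And>u v. u \<in> X \<Longrightarrow> v \<in> X \<Longrightarrow> lt u v \<Longrightarrow> u \<in> Q \<Longrightarrow> v \<in> Q"
  obtains u N where "u \<in> X" "u \<notin> Q" "q \<le> L u" "L u \<le> L w"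
    "N \<in> linear_extensions X lt" "\<And>v. v \<in> X \<Longrightarrow> N v = slide (L u) q (L v)"
    "L = reposition X q (L u) N"
proof -
  let ?P = "\<lambda>u. u \<in> X \<and> u \<notin> Q \<and> q \<le> L u"
  obtain u where u: "?P u" "\<And>v. ?P v \<Longrightarrow> L u \<le> L v"
    using ex_has_least_nat[of ?P w L] assms(2-5) by auto
  have "reposition X (L u) q L \<in> linear_extensions X lt"
  proof (rule reposition_linear_extension[OF L])
    show "q \<in> {1..card X}"
      using assms u linear_extension_range[OF L, of u] by auto
    show "\<not> lt v u" if "v \<in> X" "q \<le> L v" "L v < L u" for v
      using that u Q[of v u] by (meson leD)
  qed (use u in auto)
  then show thesis
    using that[of u "reposition X (L u) q L"] u assms(2-5) reposition_inverse[OF L] by simp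
qed

text \<open>Mirror image of \<open>move_down_outside_upset\<close>: the last element outside the
  down-set \<open>Q\<close>, up to position \<open>q\<close>, has nothing above it in the rest of
  the range.\<close>

lemma move_up_outside_downset:
  assumes L: "L \<in> linear_extensions X lt" and "w \<in> X" "w \<notin> Q" "q \<le> card X" "L w \<le> q"
    and Q: "\<And>u v. u \<in> X \<Longrightarrow> v \<in> X \<Longrightarrow> lt u v \<Longrightarrow> v \<in> Q \<Longrightarrow> u \<in> Q"
  obtains u N where "u \<in> X" "u \<notin> Q" "L w \<le> L u" "L u \<le> q"
    "N \<in> linear_extensions X lt" "\<And>v. v \<in> X \<Longrightarrow> N v = slide (L u) q (L v)"
    "L = reposition X q (L u) N"
proof -
  let ?P = "\<lambda>u. u \<in> X \<and> u \<notin> Q \<and> L u \<le> q"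
  obtain u where u: "?P u" "\<And>v. ?P v \<Longrightarrow> L v \<le> L u"
    using ex_has_greatest_nat[of ?P w L "Suc q"] assms(2-5) by (auto simp: less_Suc_eq_le)
  have "reposition X (L u) q L \<in> linear_extensions X lt"
  proof (rule reposition_linear_extension[OF L])
    show "q \<in> {1..card X}"
      using assms u linear_extension_range[OF L, of u] by auto
    show "\<not> lt u v" if "v \<in> X" "L u < L v" "L v \<le> q" for v
      using that u Q[of u v] by (meson leD)
  qed (use u in auto)
  then show thesis
    using that[of u "reposition X (L u) q L"] u assms(2-5) reposition_inverse[OF L] by simp
qed

lemma up_closure_closed:
  assumes "transp_on X lt" "A \<subseteq> X" "u \<in> X" "v \<in> X" "lt u v" "u \<in> up_closure lt A"
  shows "v \<in> up_closure lt A"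
  using assms unfolding up_closure_def transp_on_def by blast

lemma down_closure_closed:
  assumes "transp_on X lt" "A \<subseteq> X" "u \<in> X" "v \<in> X" "lt u v" "v \<in> up_closure lt\<inverse>\<inverse> A"
  shows "u \<in> up_closure lt\<inverse>\<inverse> A"
  using assms unfolding up_closure_def transp_on_def by blast

section \<open>Finiteness and order reversal\<close>

lemma finite_linear_extensions:
  assumes "finite X"
  shows "finite (linear_extensions X lt)"
proof (rule finite_subset)
  show "linear_extensions X lt \<subseteq> X \<rightarrow>\<^sub>E {1..card X}"
    by (auto simp: linear_extensions_def bij_betw_def PiE_def)
  show "finite (X \<rightarrow>\<^sub>E {1..card X})"
    using assms by (intro finite_PiE) auto
qed

lemma finite_gap_extensions:
  "finite X \<Longrightarrow> finite (gap_extensions X lt x y z a b)"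
  by (auto simp: gap_extensions_def intro: finite_subset[OF _ finite_linear_extensions])

lemma F_count_eq_card:
  "F_count X lt x y z (int a) (int b) = card (gap_extensions X lt x y z a b)"
  unfolding F_count_def gap_extensions_def
  by (rule arg_cong[where f = card]) auto

lemma reflect_linear_extension:
  assumes "L \<in> linear_extensions X lt"
  shows "(\<lambda>u\<in>X. card X + 1 - L u) \<in> linear_extensions X lt\<inverse>\<inverse>"
proof -
  have "bij_betw (\<lambda>i. card X + 1 - i) {1..card X} {1..card X}"
    by (rule bij_betw_byWitness[where f' = "\<lambda>i. card X + 1 - i"]) auto
  moreover have "bij_betw L X {1..card X}"
    using assms by (simp add: linear_extensions_def)
  ultimately have "bij_betw ((\<lambda>i. card X + 1 - i) \<circ> L) X {1..card X}"
    using bij_betw_trans by blast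
  then have "bij_betw (\<lambda>u\<in>X. card X + 1 - L u) X {1..card X}"
    by (rule bij_betw_cong[THEN iffD1, rotated]) simp
  then show ?thesis
    using assms linear_extension_range[OF assms] linear_extension_mono[OF assms]
    unfolding linear_extensions_def by (fastforce intro!: diff_less_mono2)
qed

text \<open>Reading positions backwards is injective, exchanges the roles of \<open>x\<close> and
  \<open>z\<close>, and hence swaps the two gaps.\<close>

lemma card_gap_extensions_dual_le:
  assumes "finite X" "x \<in> X" "y \<in> X" "z \<in> X"
  shows "card (gap_extensions X lt x y z a b) \<le> card (gap_extensions X lt\<inverse>\<inverse> z y x b a)"
proof (rule card_inj_on_le)
  let ?r = "\<lambda>L. (\<lambda>u\<in>X. card X + 1 - L u)"
  show "inj_on ?r (gap_extensions X lt x y z a b)"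
  proof (rule inj_onI)
    fix L M
    assume LM: "L \<in> gap_extensions X lt x y z a b" "M \<in> gap_extensions X lt x y z a b"
      and eq: "?r L = ?r M"
    then have L: "L \<in> linear_extensions X lt" and M: "M \<in> linear_extensions X lt"
      by (auto simp: gap_extensions_def)
    show "L = M"
    proof (rule extensionalityI[of _ X])
      show "L u = M u" if "u \<in> X" for u
        using fun_cong[OF eq, of u] that linear_extension_range[OF L that]
          linear_extension_range[OF M that] by simp
    qed (use L M in \<open>auto simp: linear_extensions_def\<close>)
  qed
  show "?r ` gap_extensions X lt x y z a b \<subseteq> gap_extensions X lt\<inverse>\<inverse> z y x b a"
  proof (rule image_subsetI)
    fix L assume L: "L \<in> gap_extensions X lt x y z a b"
    then have "L \<in> linear_extensions X lt" by (simp add: gap_extensions_def)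
    from reflect_linear_extension[OF this] linear_extension_range(2)[OF this assms(3)]
      linear_extension_range(2)[OF this assms(4)] L
    show "?r L \<in> gap_extensions X lt\<inverse>\<inverse> z y x b a"
      using assms(2-) by (auto simp: gap_extensions_def)
  qed
qed (simp add: assms finite_gap_extensions)

lemma card_gap_extensions_dual:
  assumes "finite X" "x \<in> X" "y \<in> X" "z \<in> X"
  shows "card (gap_extensions X lt\<inverse>\<inverse> z y x b a) = card (gap_extensions X lt x y z a b)"
  \<comment> \<open>The reverse inequality is the same lemma for the converse order, whose converse
    is \<open>lt\<close> again.\<close>
  using card_gap_extensions_dual_le[OF assms, of lt a b]
    card_gap_extensions_dual_le[of X z y x "lt\<inverse>\<inverse>" b a] assms by simp

section \<open>Codes, and shrinking the first gap\<close>

text \<open>Bounds a family whose members are all decoded from some \<open>L\<close> in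
  \<open>T\<close> and a code in \<open>C\<close>; different pairs may decode to the same
  member.\<close>

lemma card_image_code_le:
  assumes "finite T" "finite C"
  shows "card ((\<lambda>(L, c). g L c) ` (T \<times> C)) \<le> card C * card T"
  using card_image_le[of "T \<times> C" "\<lambda>(L, c). g L c"] assms
  by (simp add: card_cartesian_product mult.commute)

text \<open>Case names tell whether an element left the range below \<open>x\<close> or above
  \<open>z\<close>. If it came from the second gap, a further element is pushed up across
  \<open>y\<close> to restore the split, which gives the \<open>twice\<close> cases. The numbers
  \<open>i\<close> and \<open>j\<close> record, relative to \<open>N\<close>, the positions moved
  from.\<close>

lemma shrink_first_gap_cases:
  assumes fin: "finite X" and tr: "transp_on X lt" and X: "x \<in> X" "y \<in> X" "z \<in> X"
    and kl: "1 \<le> k" "1 \<le> l"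
    and M: "M \<in> gap_extensions X lt x y z k l"
    and L: "L \<in> gap_extensions X lt x y z (k + 1) l"
  obtains
    (below) N i where "N \<in> gap_extensions X lt x y z k l" "i \<in> {1..k}"
      "L = reposition X (N x - 1) (N x - 1 + i) N"
  | (above) N i where "N \<in> gap_extensions X lt x y z k l" "i \<in> {1..k}"
      "L = reposition X (N z + 1) (N x + i) N"
  | (below_twice) N i j where "N \<in> gap_extensions X lt x y z k l" "i \<in> {1..k}" "j \<in> {1..<l}"
      "L = reposition X (N x - 1) (N y + j) (reposition X (N y + 1) (N x + i) N)"
  | (above_twice) N i j where "N \<in> gap_extensions X lt x y z k l" "i \<in> {1..k}" "j \<in> {1..<l}"
      "L = reposition X (N z + 1) (N y + 1 + j) (reposition X (N y + 1) (N x + i) N)"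
proof -
  have LE: "L \<in> linear_extensions X lt" and Ly: "L y = L x + k + 1" and Lz: "L z = L x + k + 1 + l"
    using L by (auto simp: gap_extensions_def)
  have ME: "M \<in> linear_extensions X lt" and My: "M y = M x + k" and Mz: "M z = M x + k + l"
    using M by (auto simp: gap_extensions_def)
  note Lrange = linear_extension_range[OF LE]
  note Linj = linear_extension_inj[OF LE]
  note Mmono = linear_extension_mono[OF ME]
  note up = up_closure_closed[OF tr]
  note down = down_closure_closed[OF tr]
  show thesis
  proof (cases "\<exists>w\<in>X. L x < L w \<and> L w < L y \<and> \<not> lt x w")
    case True
    then obtain w where w: "w \<in> X" "L x < L w" "L w < L y" "\<not> lt x w" by blast
    obtain u N where u: "u \<in> X" "u \<notin> up_closure lt {x}" "L x \<le> L u" "L u \<le> L w"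
      "N \<in> linear_extensions X lt"
      "\<And>t. t \<in> X \<Longrightarrow> N t = slide (L u) (L x) (L t)" "L = reposition X (L x) (L u) N"
      by (rule move_down_outside_upset[OF LE w(1), of "up_closure lt {x}" "L x"])
        (use w X up[of "{x}"] Lrange[of x] in \<open>auto simp: up_closure_def\<close>)
    have ux: "L x < L u" using u(1-4) Linj[of u x] X by (auto simp: up_closure_def)
    have N: "N x = L x + 1" "N y = L y" "N z = L z"
      using X u(1-4) ux w Ly Lz by (auto simp: u(6) slide_def)
    show thesis
    proof (rule below[of N "L u - L x"])
      show "N \<in> gap_extensions X lt x y z k l"
        using u(5) N Ly Lz by (simp add: gap_extensions_def)
      show "L u - L x \<in> {1..k}" using ux u(1-4) w Ly by auto
      show "L = reposition X (N x - 1) (N x - 1 + (L u - L x)) N"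
        using ux u(7) N by simp
    qed
  next
    case False
    then have above_x: "lt x w" if "w \<in> X" "L x < L w" "L w < L y" for w
      using that by blast
    \<comment> \<open>\<open>L\<close> has \<open>k\<close> elements strictly between
      \<open>x\<close> and \<open>y\<close>, but \<open>M\<close> only \<open>k - 1\<close>. As all
      of these in \<open>L\<close> are above \<open>x\<close>, one of them is not below
      \<open>y\<close>.\<close>
    have "\<not> {v\<in>X. L v \<in> {L x<..<L y}} \<subseteq> {v\<in>X. M v \<in> {M x<..<M y}}"
    proof
      assume "{v\<in>X. L v \<in> {L x<..<L y}} \<subseteq> {v\<in>X. M v \<in> {M x<..<M y}}"
      then have "card {L x<..<L y} \<le> card {M x<..<M y}"
        using X linear_extension_range[OF ME, of y] Lrange[of y]
        by (intro card_positions_mono[OF fin LE ME]) auto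
      then show False using Ly My kl by simp
    qed
    then obtain v0 where v0: "v0 \<in> X" "L x < L v0" "L v0 < L y" "\<not> lt v0 y"
      using above_x Mmono X by (auto simp: subset_eq)
    \<comment> \<open>Likewise \<open>k + l\<close> elements lie strictly between \<open>x\<close>
      and \<open>z\<close> in \<open>L\<close>, against \<open>k + l - 1\<close> in
      \<open>M\<close>. An element in both closures would be forced into this range.\<close>
    have "\<exists>w\<in>X. L x < L w \<and> L w < L z
        \<and> (w \<notin> up_closure lt {x, y} \<or> w \<notin> up_closure lt\<inverse>\<inverse> {y, z})"
    proof (rule ccontr)
      assume A: "\<not> ?thesis"
      have "{v\<in>X. L v \<in> {L x<..<L z}} \<subseteq> {v\<in>X. M v \<in> {M x<..<M z}}"
      proof
        fix v assume v: "v \<in> {v\<in>X. L v \<in> {L x<..<L z}}"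
        then have "v \<in> up_closure lt {x, y}" "v \<in> up_closure lt\<inverse>\<inverse> {y, z}" "v \<noteq> x" "v \<noteq> z"
          using A by auto
        then show "v \<in> {v\<in>X. M v \<in> {M x<..<M z}}"
          using v Mmono[of x v] Mmono[of y v] Mmono[of v y] Mmono[of v z] X My Mz kl
          by (auto simp: up_closure_def)
      qed
      then have "card {L x<..<L z} \<le> card {M x<..<M z}"
        using X linear_extension_range[OF ME, of z] Lrange[of z]
        by (intro card_positions_mono[OF fin LE ME]) auto
      then show False using Lz Mz kl by simp
    qed
    then obtain w where w: "w \<in> X" "L x < L w" "L w < L z"
      "w \<notin> up_closure lt {x, y} \<or> w \<notin> up_closure lt\<inverse>\<inverse> {y, z}" by blast
    from w(4) show thesis
    proof
      assume wu: "w \<notin> up_closure lt {x, y}"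
      obtain u K where u: "u \<in> X" "u \<notin> up_closure lt {x, y}" "L x \<le> L u" "L u \<le> L w"
        "K \<in> linear_extensions X lt"
        "\<And>t. t \<in> X \<Longrightarrow> K t = slide (L u) (L x) (L t)" "L = reposition X (L x) (L u) K"
        by (rule move_down_outside_upset[OF LE w(1) wu, of "L x"])
          (use w X up[of "{x, y}"] Lrange[of x] in auto)
      have "L u \<noteq> L x" "L u \<noteq> L y" "\<not> lt x u"
        using u(1-4) X Linj[of u] by (auto simp: up_closure_def)
      \<comment> \<open>By \<open>above_x\<close>, an element not above \<open>x\<close> cannot come
        from the first gap.\<close>
      then have uy: "L y < L u"
        using above_x[of u] u(1-4) by force
      \<comment> \<open>The gaps are now \<open>k + 1\<close> and \<open>l - 1\<close>;
        \<open>v0\<close> still precedes \<open>y\<close>, so some element can be pushed up across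
        \<open>y\<close>.\<close>
      have K: "K x = L x + 1" "K y = L y + 1" "K z = L z" "K v0 = L v0 + 1"
        using X u(1-4) uy w Ly Lz v0 by (auto simp: u(6) slide_def)
      obtain v N where v: "v \<in> X" "v \<notin> up_closure lt\<inverse>\<inverse> {y}" "K v0 \<le> K v" "K v \<le> K y"
        "N \<in> linear_extensions X lt"
        "\<And>t. t \<in> X \<Longrightarrow> N t = slide (K v) (K y) (K t)" "K = reposition X (K y) (K v) N"
        by (rule move_up_outside_downset[OF u(5) v0(1), of "up_closure lt\<inverse>\<inverse> {y}" "K y"])
          (use v0 K X down[of "{y}"] linear_extension_range[OF u(5), of y] in
            \<open>auto simp: up_closure_def\<close>)
      have vy: "K v < K y"
        using v(1-4) linear_extension_inj[OF u(5), of v y] X by (force simp: up_closure_def)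
      have N: "N x = L x + 1" "N y = L y" "N z = L z"
        using X v(3) vy v0 uy u(4) w(3) Ly Lz kl K by (auto simp: v(6) slide_def)
      show thesis
      proof (rule below_twice[of N "K v - N x" "L u - L y"])
        show "N \<in> gap_extensions X lt x y z k l"
          using v(5) N Ly Lz by (simp add: gap_extensions_def)
        show "K v - N x \<in> {1..k}" "L u - L y \<in> {1..<l}"
          using vy v(1-4) v0 uy u(1-4) w Ly Lz unfolding K N by auto
        have e: "N x - 1 = L x" "N y + (L u - L y) = L u" "N y + 1 = K y"
          "N x + (K v - N x) = K v"
          using vy v(1-4) v0 uy unfolding K N by auto
        show "L = reposition X (N x - 1) (N y + (L u - L y))
            (reposition X (N y + 1) (N x + (K v - N x)) N)"
          by (simp only: e flip: v(7) u(7))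
      qed
    next
      assume wu: "w \<notin> up_closure lt\<inverse>\<inverse> {y, z}"
      obtain u K where u: "u \<in> X" "u \<notin> up_closure lt\<inverse>\<inverse> {y, z}" "L w \<le> L u" "L u \<le> L z"
        "K \<in> linear_extensions X lt"
        "\<And>t. t \<in> X \<Longrightarrow> K t = slide (L u) (L z) (L t)" "L = reposition X (L z) (L u) K"
        by (rule move_up_outside_downset[OF LE w(1) wu, of "L z"])
          (use w X down[of "{y, z}"] Lrange[of z] in auto)
      have "L u \<noteq> L y" "L u \<noteq> L z"
        using u(1-4) X Linj[of u] by (auto simp: up_closure_def)
      then consider "L u < L y" | "L y < L u" "L u < L z"
        using u(4) by linarith
      then show thesis
      proof cases
        case 1
        \<comment> \<open>Here \<open>u\<close> leaves the first gap, so the gaps are already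
          \<open>k\<close> and \<open>l\<close>.\<close>
        have K: "K x = L x" "K y = L y - 1" "K z = L z - 1"
          using X u(1-4) 1 w Ly Lz by (auto simp: u(6) slide_def)
        show thesis
        proof (rule above[of K "L u - L x"])
          show "K \<in> gap_extensions X lt x y z k l"
            using u(5) K Ly Lz by (simp add: gap_extensions_def)
          show "L u - L x \<in> {1..k}" using 1 u(1-4) w Ly by auto
          have e: "K z + 1 = L z" "K x + (L u - L x) = L u"
            using u(1-4) w unfolding K by auto
          show "L = reposition X (K z + 1) (K x + (L u - L x)) K"
            by (simp only: e flip: u(7))
        qed
      next
        case 2
        \<comment> \<open>Here \<open>u\<close> leaves the second gap; the gaps \<open>k + 1\<close>
          and \<open>l - 1\<close> again call for a move across \<open>y\<close>.\<close>
        have K: "K x = L x" "K y = L y" "K z = L z - 1" "K v0 = L v0"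
          using X u(1-4) 2 w Ly Lz v0 by (auto simp: u(6) slide_def)
        obtain v N where v: "v \<in> X" "v \<notin> up_closure lt\<inverse>\<inverse> {y}" "K v0 \<le> K v" "K v \<le> K y"
          "N \<in> linear_extensions X lt"
          "\<And>t. t \<in> X \<Longrightarrow> N t = slide (K v) (K y) (K t)" "K = reposition X (K y) (K v) N"
          by (rule move_up_outside_downset[OF u(5) v0(1), of "up_closure lt\<inverse>\<inverse> {y}" "K y"])
            (use v0 K X down[of "{y}"] linear_extension_range[OF u(5), of y] in
              \<open>auto simp: up_closure_def\<close>)
        have vy: "K v < K y"
          using v(1-4) linear_extension_inj[OF u(5), of v y] X by (force simp: up_closure_def)
        have N: "N x = L x" "N y = L y - 1" "N z = L z - 1"
          using X v(3) vy v0 2 Ly Lz kl K by (auto simp: v(6) slide_def)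
        show thesis
        proof (rule above_twice[of N "K v - N x" "L u - L y"])
          show "N \<in> gap_extensions X lt x y z k l"
            using v(5) N Ly Lz by (simp add: gap_extensions_def)
          show "K v - N x \<in> {1..k}" "L u - L y \<in> {1..<l}"
            using vy v(1-4) v0 2 u(1-4) w Ly Lz unfolding K N by auto
          have e: "N z + 1 = L z" "K y + (L u - L y) = L u" "N y + 1 = K y"
            "N x + (K v - N x) = K v"
            using vy v(1-4) v0 2 unfolding K N by auto
          show "L = reposition X (N z + 1) (N y + 1 + (L u - L y))
              (reposition X (N y + 1) (N x + (K v - N x)) N)"
            by (simp only: e flip: v(7) u(7))
        qed
      qed
    qed
  qed
qed

text \<open>The four cases need \<open>k\<close>, \<open>k\<close>, \<open>k * (l - 1)\<close> and
  \<open>k * (l - 1)\<close> codes.\<close>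

lemma card_shrink_first_gap:
  assumes "finite X" "transp_on X lt" "x \<in> X" "y \<in> X" "z \<in> X" "1 \<le> k" "1 \<le> l"
    and "gap_extensions X lt x y z k l \<noteq> {}"
  shows "card (gap_extensions X lt x y z (k + 1) l)
      \<le> 2 * k * l * card (gap_extensions X lt x y z k l)"
proof -
  let ?T = "gap_extensions X lt x y z k l"
  let ?A = "(\<lambda>(N, i). reposition X (N x - 1) (N x - 1 + i) N) ` (?T \<times> {1..k})"
  let ?B = "(\<lambda>(N, i). reposition X (N z + 1) (N x + i) N) ` (?T \<times> {1..k})"
  let ?C = "(\<lambda>(N, c). (\<lambda>(i, j). reposition X (N x - 1) (N y + j)
      (reposition X (N y + 1) (N x + i) N)) c) ` (?T \<times> ({1..k} \<times> {1..<l}))"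
  let ?D = "(\<lambda>(N, c). (\<lambda>(i, j). reposition X (N z + 1) (N y + 1 + j)
      (reposition X (N y + 1) (N x + i) N)) c) ` (?T \<times> ({1..k} \<times> {1..<l}))"
  obtain M where M: "M \<in> ?T" using assms by blast
  have fin: "finite ?T" by (simp add: assms finite_gap_extensions)
  have "gap_extensions X lt x y z (k + 1) l \<subseteq> ?A \<union> ?B \<union> (?C \<union> ?D)"
  proof
    fix L assume "L \<in> gap_extensions X lt x y z (k + 1) l"
    from assms(1-7) M this show "L \<in> ?A \<union> ?B \<union> (?C \<union> ?D)"
    proof (rule shrink_first_gap_cases)
      fix N i assume "N \<in> ?T" "i \<in> {1..k}" "L = reposition X (N x - 1) (N x - 1 + i) N"
      then have "L \<in> ?A" by (intro image_eqI[where x = "(N, i)"]) auto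
      then show ?thesis by (intro UnI1)
    next
      fix N i assume "N \<in> ?T" "i \<in> {1..k}" "L = reposition X (N z + 1) (N x + i) N"
      then have "L \<in> ?B" by (intro image_eqI[where x = "(N, i)"]) auto
      then show ?thesis by (rule UnI2[THEN UnI1])
    next
      fix N i j assume "N \<in> ?T" "i \<in> {1..k}" "j \<in> {1..<l}"
        "L = reposition X (N x - 1) (N y + j) (reposition X (N y + 1) (N x + i) N)"
      then have "L \<in> ?C" by (intro image_eqI[where x = "(N, i, j)"]) auto
      then show ?thesis by (rule UnI1[THEN UnI2])
    next
      fix N i j assume "N \<in> ?T" "i \<in> {1..k}" "j \<in> {1..<l}"
        "L = reposition X (N z + 1) (N y + 1 + j) (reposition X (N y + 1) (N x + i) N)"
      then have "L \<in> ?D" by (intro image_eqI[where x = "(N, i, j)"]) auto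
      then show ?thesis by (rule UnI2[THEN UnI2])
    qed
  qed
  then have "card (gap_extensions X lt x y z (k + 1) l) \<le> card (?A \<union> ?B \<union> (?C \<union> ?D))"
    using fin by (intro card_mono) auto
  also have "\<dots> \<le> (card ?A + card ?B) + (card ?C + card ?D)"
    by (intro card_Un_le[THEN order_trans] add_mono card_Un_le)
  also have "\<dots> \<le> (k * card ?T + k * card ?T)
      + ((k * (l - 1)) * card ?T + (k * (l - 1)) * card ?T)"
    using card_image_code_le[OF fin, of "{1..k}"]
      card_image_code_le[OF fin, of "{1..k} \<times> {1..<l}"]
    by (intro add_mono) (simp_all add: card_cartesian_product)
  \<comment> \<open>Splitting on \<open>l\<close> removes the truncated
    \<open>l - 1\<close>.\<close>
  also have "\<dots> = 2 * k * l * card ?T"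
    using assms(7) by (cases l) (simp_all add: algebra_simps)
  finally show ?thesis .
qed

section \<open>Growing the second gap\<close>

text \<open>The second gap gains an element either from after \<open>z\<close>, or across
  \<open>y\<close> from below. In the latter case the first gap keeps its size, because the crossing
  element starts before \<open>x\<close> or is replaced by one that moves up across
  \<open>x\<close>. The number \<open>p\<close> is the original position of the element entering
  from outside.\<close>

lemma grow_second_gap_cases:
  assumes fin: "finite X" and tr: "transp_on X lt" and X: "x \<in> X" "y \<in> X" "z \<in> X"
    and kl: "1 \<le> k" "1 \<le> l"
    and M: "M \<in> gap_extensions X lt x y z (k + 1) (l + 1)"
    and L: "L \<in> gap_extensions X lt x y z (k + 1) l"
  obtains
    (above) N p where "N \<in> gap_extensions X lt x y z (k + 1) (l + 1)" "p \<in> {1..card X}"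
      "N x < p" "L = reposition X (N z - 1) p N"
  | (below) N p where "N \<in> gap_extensions X lt x y z (k + 1) (l + 1)" "p \<in> {1..card X}"
      "p \<le> N x" "L = reposition X (N y + 1) p N"
  | (below_twice) N p i where "N \<in> gap_extensions X lt x y z (k + 1) (l + 1)"
      "p \<in> {1..card X}" "i \<in> {1..k}"
      "L = reposition X (N x + 1) p (reposition X (N y + 1) (N x + 1 + i) N)"
proof -
  have LE: "L \<in> linear_extensions X lt" and Ly: "L y = L x + k + 1" and Lz: "L z = L x + k + 1 + l"
    using L by (auto simp: gap_extensions_def)
  have ME: "M \<in> linear_extensions X lt" and My: "M y = M x + k + 1" and Mz: "M z = M y + l + 1"
    using M by (auto simp: gap_extensions_def)
  note Lrange = linear_extension_range[OF LE]
  note Linj = linear_extension_inj[OF LE]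
  note Mmono = linear_extension_mono[OF ME]
  note up = up_closure_closed[OF tr]
  note down = down_closure_closed[OF tr]
  show thesis
  proof (cases "\<exists>w\<in>X. L z < L w \<and> \<not> lt z w")
    case True
    then obtain w where w: "w \<in> X" "L z < L w" "\<not> lt z w" by blast
    obtain u N where u: "u \<in> X" "u \<notin> up_closure lt {z}" "L z \<le> L u" "L u \<le> L w"
      "N \<in> linear_extensions X lt"
      "\<And>t. t \<in> X \<Longrightarrow> N t = slide (L u) (L z) (L t)" "L = reposition X (L z) (L u) N"
      by (rule move_down_outside_upset[OF LE w(1), of "up_closure lt {z}" "L z"])
        (use w X up[of "{z}"] Lrange[of z] in \<open>auto simp: up_closure_def\<close>)
    have uz: "L z < L u" using u(1-4) Linj[of u z] X by (auto simp: up_closure_def)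
    have N: "N x = L x" "N y = L y" "N z = L z + 1"
      using X u(1-4) uz w Ly Lz kl by (auto simp: u(6) slide_def)
    show thesis
    proof (rule above[of N "L u"])
      show "N \<in> gap_extensions X lt x y z (k + 1) (l + 1)"
        using u(5) N Ly Lz by (simp add: gap_extensions_def)
      show "L u \<in> {1..card X}" using Lrange u(1-4) by auto
      show "N x < L u" unfolding N using uz Lz by simp
      show "L = reposition X (N z - 1) (L u) N"
        using u(7) N by simp
    qed
  next
    case False
    \<comment> \<open>Everything after \<open>z\<close> in \<open>L\<close> is above
      \<open>z\<close>, hence also after \<open>z\<close> in \<open>M\<close>. So \<open>z\<close>
      is no later in \<open>M\<close>, and the longer gaps of \<open>M\<close> put \<open>y\<close>
      and \<open>x\<close> strictly earlier than in \<open>L\<close>.\<close>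
    have "{v\<in>X. L v \<in> {L z<..card X}} \<subseteq> {v\<in>X. M v \<in> {M z<..card X}}"
      using False Mmono X linear_extension_range[OF ME] by auto
    then have "card {L z<..card X} \<le> card {M z<..card X}"
      by (intro card_positions_mono[OF fin LE ME]) auto
    then have "M z \<le> L z"
      using Lrange[of z] linear_extension_range[OF ME, of z] X by simp
    then have lt_y: "M y < L y" and lt_x: "M x < L x"
      using Ly Lz My Mz by auto
    have not_below: "\<not> {v\<in>X. L v \<in> {1..<L t}} \<subseteq> {v\<in>X. M v \<in> {1..<M t}}"
      if "t \<in> X" "M t < L t" for t
    proof
      assume "{v\<in>X. L v \<in> {1..<L t}} \<subseteq> {v\<in>X. M v \<in> {1..<M t}}"
      then have "card {1..<L t} \<le> card {1..<M t}"
        using linear_extension_range[OF ME that(1)] Lrange[OF that(1)]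
        by (intro card_positions_mono[OF fin LE ME]) auto
      then show False using that Lrange[OF that(1)] linear_extension_range[OF ME that(1)] by simp
    qed
    \<comment> \<open>More elements precede \<open>x\<close> in \<open>L\<close> than in
      \<open>M\<close>, so not all of them are forced below \<open>x\<close>.\<close>
    obtain w' where w': "w' \<in> X" "L w' < L x" "\<not> lt w' x"
      using not_below[OF X(1) lt_x] Mmono X linear_extension_range[OF ME]
      by (auto simp: subset_eq)
    show thesis
    proof (cases "\<exists>w\<in>X. L x < L w \<and> L w < L y \<and> \<not> lt w y")
      case True
      then obtain w where w: "w \<in> X" "L x < L w" "L w < L y" "\<not> lt w y" by blast
      obtain u K where u: "u \<in> X" "u \<notin> up_closure lt\<inverse>\<inverse> {x}" "L w' \<le> L u" "L u \<le> L x"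
        "K \<in> linear_extensions X lt"
        "\<And>t. t \<in> X \<Longrightarrow> K t = slide (L u) (L x) (L t)" "L = reposition X (L x) (L u) K"
        by (rule move_up_outside_downset[OF LE w'(1), of "up_closure lt\<inverse>\<inverse> {x}" "L x"])
          (use w' X down[of "{x}"] Lrange[of x] in \<open>auto simp: up_closure_def\<close>)
      have ux: "L u < L x" using u(1-4) Linj[of u x] X by (force simp: up_closure_def)
      \<comment> \<open>The first gap is temporarily \<open>k + 2\<close>; pushing \<open>v\<close>
        across \<open>y\<close> turns the gaps into \<open>k + 1\<close> and
        \<open>l + 1\<close>.\<close>
      have K: "K x = L x - 1" "K y = L y" "K z = L z" "K w = L w"
        using X u(1-4) ux w Ly Lz by (auto simp: u(6) slide_def)
      obtain v N where v: "v \<in> X" "v \<notin> up_closure lt\<inverse>\<inverse> {y}" "K w \<le> K v" "K v \<le> K y"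
        "N \<in> linear_extensions X lt"
        "\<And>t. t \<in> X \<Longrightarrow> N t = slide (K v) (K y) (K t)" "K = reposition X (K y) (K v) N"
        by (rule move_up_outside_downset[OF u(5) w(1), of "up_closure lt\<inverse>\<inverse> {y}" "K y"])
          (use w K X down[of "{y}"] linear_extension_range[OF u(5), of y] in
            \<open>auto simp: up_closure_def\<close>)
      have vy: "K v < K y"
        using v(1-4) linear_extension_inj[OF u(5), of v y] X by (force simp: up_closure_def)
      have N: "N x = L x - 1" "N y = L y - 1" "N z = L z"
        using X v(3) vy w Ly Lz kl K by (auto simp: v(6) slide_def)
      show thesis
      proof (rule below_twice[of N "L u" "K v - L x"])
        show "N \<in> gap_extensions X lt x y z (k + 1) (l + 1)"
          using v(5) N Ly Lz ux by (simp add: gap_extensions_def)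
        show "L u \<in> {1..card X}" using Lrange u(1-4) by auto
        show "K v - L x \<in> {1..k}"
          using vy v(1-4) w Ly Lz unfolding K by auto
        have e: "N x + 1 = L x" "N y + 1 = K y" "L x + (K v - L x) = K v"
          using vy v(1-4) w ux unfolding K N by auto
        show "L = reposition X (N x + 1) (L u)
            (reposition X (N y + 1) (N x + 1 + (K v - L x)) N)"
          by (simp only: e flip: v(7) u(7))
      qed
    next
      case inner: False
      \<comment> \<open>Otherwise every element before \<open>y\<close> in \<open>L\<close> would be
        forced before \<open>y\<close> in \<open>M\<close>, where \<open>y\<close> comes strictly
        earlier.\<close>
      have "\<exists>w\<in>X. L w < L x \<and> w \<notin> up_closure lt\<inverse>\<inverse> {x, y}"
      proof (rule ccontr)
        assume A: "\<not> ?thesis"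
        have "M v < M y" if v: "v \<in> X" "L v < L y" for v
        proof -
          have "v \<in> up_closure lt\<inverse>\<inverse> {x, y}"
            using A inner v Linj[of v x] X
            by (cases "L v" "L x" rule: linorder_cases) (auto simp: up_closure_def)
          moreover have "v \<noteq> y" using v by auto
          ultimately show ?thesis
            using v Mmono[of v x] Mmono[of v y] X My by (auto simp: up_closure_def)
        qed
        then have "{v\<in>X. L v \<in> {1..<L y}} \<subseteq> {v\<in>X. M v \<in> {1..<M y}}"
          using linear_extension_range[OF ME] by auto
        with not_below[OF X(2) lt_y] show False by blast
      qed
      then obtain w where w: "w \<in> X" "L w < L x" "w \<notin> up_closure lt\<inverse>\<inverse> {x, y}" by blast
      obtain u N where u: "u \<in> X" "u \<notin> up_closure lt\<inverse>\<inverse> {x, y}" "L w \<le> L u" "L u \<le> L y"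
        "N \<in> linear_extensions X lt"
        "\<And>t. t \<in> X \<Longrightarrow> N t = slide (L u) (L y) (L t)" "L = reposition X (L y) (L u) N"
        by (rule move_up_outside_downset[OF LE w(1,3), of "L y"])
          (use w X down[of "{x, y}"] Lrange[of y] Ly in auto)
      have "L u \<noteq> L x" "L u \<noteq> L y" "\<not> lt u y"
        using u(1-4) X Linj[of u] by (auto simp: up_closure_def)
      \<comment> \<open>By \<open>inner\<close>, everything between \<open>x\<close> and
        \<open>y\<close> is below \<open>y\<close>, so \<open>u\<close> crosses both
        \<open>x\<close> and \<open>y\<close> and the first gap is unchanged.\<close>
      then have ux: "L u < L x"
        using inner u(1-4) by force
      have N: "N x = L x - 1" "N y = L y - 1" "N z = L z"
        using X u(1-4) ux w Ly Lz kl by (auto simp: u(6) slide_def)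
      show thesis
      proof (rule below[of N "L u"])
        show "N \<in> gap_extensions X lt x y z (k + 1) (l + 1)"
          using u(5) N Ly Lz ux by (simp add: gap_extensions_def)
        show "L u \<in> {1..card X}" using Lrange u(1-4) by auto
        show "L u \<le> N x" unfolding N using ux by simp
        have e: "N y + 1 = L y" unfolding N using ux Ly by simp
        show "L = reposition X (N y + 1) (L u) N"
          by (simp only: e flip: u(7))
      qed
    qed
  qed
qed

text \<open>Single moves need \<open>card X\<close> codes in total, double moves
  \<open>card X * k\<close>.\<close>

lemma card_grow_second_gap:
  assumes "finite X" "transp_on X lt" "x \<in> X" "y \<in> X" "z \<in> X" "1 \<le> k" "1 \<le> l"
    and "gap_extensions X lt x y z (k + 1) (l + 1) \<noteq> {}"
  shows "card (gap_extensions X lt x y z (k + 1) l)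
      \<le> (k + 1) * card X * card (gap_extensions X lt x y z (k + 1) (l + 1))"
proof -
  let ?T = "gap_extensions X lt x y z (k + 1) (l + 1)"
  \<comment> \<open>The position \<open>p\<close> itself tells an element moved down below \<open>z\<close> from one moved up above
    \<open>y\<close>, so these two cases together need only \<open>card X\<close> codes.\<close>
  let ?A = "(\<lambda>(N, p). if N x < p then reposition X (N z - 1) p N
      else reposition X (N y + 1) p N) ` (?T \<times> {1..card X})"
  let ?B = "(\<lambda>(N, c). (\<lambda>(p, i). reposition X (N x + 1) p
      (reposition X (N y + 1) (N x + 1 + i) N)) c) ` (?T \<times> ({1..card X} \<times> {1..k}))"
  obtain M where M: "M \<in> ?T" using assms by blast
  have fin: "finite ?T" by (simp add: assms finite_gap_extensions)
  have "gap_extensions X lt x y z (k + 1) l \<subseteq> ?A \<union> ?B"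
  proof
    fix L assume "L \<in> gap_extensions X lt x y z (k + 1) l"
    from assms(1-7) M this show "L \<in> ?A \<union> ?B"
    proof (rule grow_second_gap_cases)
      fix N p assume "N \<in> ?T" "p \<in> {1..card X}" "N x < p" "L = reposition X (N z - 1) p N"
      then show ?thesis by (intro UnI1 image_eqI[where x = "(N, p)"]) auto
    next
      fix N p assume "N \<in> ?T" "p \<in> {1..card X}" "p \<le> N x" "L = reposition X (N y + 1) p N"
      then show ?thesis by (intro UnI1 image_eqI[where x = "(N, p)"]) auto
    next
      fix N p i assume "N \<in> ?T" "p \<in> {1..card X}" "i \<in> {1..k}"
        "L = reposition X (N x + 1) p (reposition X (N y + 1) (N x + 1 + i) N)"
      then show ?thesis by (intro UnI2 image_eqI[where x = "(N, p, i)"]) auto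
    qed
  qed
  then have "card (gap_extensions X lt x y z (k + 1) l) \<le> card (?A \<union> ?B)"
    using fin by (intro card_mono) auto
  also have "\<dots> \<le> card ?A + card ?B"
    by (rule card_Un_le)
  also have "\<dots> \<le> card X * card ?T + (card X * k) * card ?T"
    using card_image_code_le[OF fin, of "{1..card X}"]
      card_image_code_le[OF fin, of "{1..card X} \<times> {1..k}"]
    by (intro add_mono) (simp_all add: card_cartesian_product)
  also have "\<dots> = (k + 1) * card X * card ?T"
    by (simp add: algebra_simps)
  finally show ?thesis .
qed

section \<open>Combining the bounds\<close>

lemma cross_product_converse:
  fixes k l :: nat
  assumes X: "finite X" "transp_on X lt" "x \<in> X" "y \<in> X" "z \<in> X" and kl: "1 \<le> k" "1 \<le> l"
    and ne: "gap_extensions X lt x y z k l \<noteq> {}"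
      "gap_extensions X lt x y z (k + 1) (l + 1) \<noteq> {}"
  defines "f \<equiv> \<lambda>a b. card (gap_extensions X lt x y z a b)"
  shows "f (k + 1) l * f k (l + 1)
      \<le> 2 * k * l * (min k l + 1) * card X * (f k l * f (k + 1) (l + 1))"
proof -
  have trd: "transp_on X lt\<inverse>\<inverse>" using X by simp
  have ned: "gap_extensions X lt\<inverse>\<inverse> z y x l k \<noteq> {}"
    "gap_extensions X lt\<inverse>\<inverse> z y x (l + 1) (k + 1) \<noteq> {}"
    using ne card_gap_extensions_dual[OF X(1,3-5), of lt] X(1)
    by (metis card_0_eq finite_gap_extensions)+
  note dual = card_gap_extensions_dual[OF X(1,3-5), of lt]
  have a1: "f (k + 1) l \<le> 2 * k * l * f k l"
    unfolding f_def by (rule card_shrink_first_gap[OF X kl ne(1)])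
  \<comment> \<open>Order reversal exchanges \<open>x\<close> with \<open>z\<close> and
    \<open>k\<close> with \<open>l\<close>, so growth of the second gap becomes growth of the
    first.\<close>
  have a2: "f k (l + 1) \<le> 2 * k * l * f k l"
    using card_shrink_first_gap[OF X(1) trd X(5,4,3) kl(2,1) ned(1)]
    unfolding f_def dual by (simp add: mult_ac)
  have b1: "f (k + 1) l \<le> (k + 1) * card X * f (k + 1) (l + 1)"
    unfolding f_def by (rule card_grow_second_gap[OF X kl ne(2)])
  have b2: "f k (l + 1) \<le> (l + 1) * card X * f (k + 1) (l + 1)"
    using card_grow_second_gap[OF X(1) trd X(5,4,3) kl(2,1) ned(2)]
    unfolding f_def dual by simp
  show ?thesis
  \<comment> \<open>\<open>b1\<close> carries the factor \<open>k + 1\<close> and \<open>b2\<close>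
    the factor \<open>l + 1\<close>; the smaller one is paired with the \<open>2 * k * l\<close>
    bound on the other count.\<close>
  proof (cases "k \<le> l")
    case True
    then show ?thesis using mult_mono[OF b1 a2] by (simp add: algebra_simps)
  next
    case False
    then show ?thesis using mult_mono[OF a1 b2] by (simp add: algebra_simps)
  qed
qed

theorem theorem1p4:
  fixes X :: "'a set" and lt :: "'a \<Rightarrow> 'a \<Rightarrow> bool"
    and x y z :: 'a and n :: nat and k l :: int
  defines "F \<equiv> F_count X lt x y z"
  assumes "finite X" and "strict_poset X lt" and "card X = n"
    and "x \<in> X" and "y \<in> X" and "z \<in> X"
    and "x \<noteq> y" and "y \<noteq> z" and "x \<noteq> z"
    and "k \<ge> 1" and "l \<ge> 1"
    and "F k l * F (k + 1) (l + 1) > 0"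
  shows "int (F (k + 1) l * F k (l + 1))
           \<le> 2 * k * l * (min k l + 1) * int n * int (F k l * F (k + 1) (l + 1))"
proof -
  obtain a b where ab: "k = int a" "l = int b"
    using assms by (metis zero_le_imp_eq_int order_trans zero_le_one)
  let ?f = "\<lambda>a b. card (gap_extensions X lt x y z a b)"
  have F: "F k l = ?f a b" "F (k + 1) l = ?f (a + 1) b" "F k (l + 1) = ?f a (b + 1)"
    "F (k + 1) (l + 1) = ?f (a + 1) (b + 1)"
    unfolding F_def ab by (simp_all flip: F_count_eq_card add: add.commute)
  have "?f (a + 1) b * ?f a (b + 1)
      \<le> 2 * a * b * (min a b + 1) * card X * (?f a b * ?f (a + 1) (b + 1))"
  proof (rule cross_product_converse)
    show "gap_extensions X lt x y z a b \<noteq> {}"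
      "gap_extensions X lt x y z (a + 1) (b + 1) \<noteq> {}"
      using assms(13) unfolding F by auto
  qed (use assms ab in \<open>auto simp: strict_poset_def\<close>)
  then have "int (?f (a + 1) b * ?f a (b + 1))
      \<le> int (2 * a * b * (min a b + 1) * card X * (?f a b * ?f (a + 1) (b + 1)))"
    by (simp only: of_nat_le_iff)
  then show ?thesis
    \<comment> \<open>The fact \<open>F\<close> goes first, since its left-hand sides still mention
      \<open>k\<close> and \<open>l\<close>.\<close>
    unfolding F unfolding ab using assms(4) by (simp add: of_nat_min algebra_simps)
qed

end
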